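(* Consider $n$ nodes placed at the integer points of a segment of the real line, and choose an integer $b > 1$. With $\ell = (b-1)\lceil \log_b n\rceil$, let each node link to the nodes at distances $1x, 2x, 3x, \ldots, (b-1)x$ from it, for each $x \in \{b^0, b^1, \ldots, b^{\lceil \log_b n\rceil - 1}\}$ (whenever such nodes exist). Messages are routed greedily, each node forwarding the message to its neighbor closest to the target. Then the delivery time is $T(n) = O(\log_b n)$.
   Context: The delivery time is the number of hops taken to route a message from a source to a target node. *)

theory Defs
  imports Complex_Main "HOL-Library.Landau_Symbols" "HOL-Library.Extended_Real"
begin

definition nodes :: "nat \<Rightarrow> int set" where
  "nodes n = {0..<int n}"

definition num_scales :: "nat \<Rightarrow> nat \<Rightarrow> nat" where
  "num_scales b n = nat \<lceil>log (real b) (real n)\<rceil>"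

definition link_distances :: "nat \<Rightarrow> nat \<Rightarrow> nat set" where
  "link_distances b n = {j * b ^ i | j i. 1 \<le> j \<and> j \<le> b - 1 \<and> i < num_scales b n}"

text \<open>The parameter \<open>\<ell>\<close> is the number of distances at which a node has links.\<close>

lemma card_link_distances:
  assumes "b > 1"
  shows "card (link_distances b n) = (b - 1) * nat \<lceil>log (real b) (real n)\<rceil>"
proof -
  let ?f = "\<lambda>(j::nat, i::nat). j * b ^ i"
  let ?A = "{1..b - 1} \<times> {..<num_scales b n}"
  have le: "i' \<le> i" if "j * b ^ i = j' * b ^ i'" "j < b" "0 < j'" for j j' i i' :: nat
  proof (rule ccontr)
    assume "\<not> i' \<le> i"
    then obtain d where d: "i' = i + Suc d" by (metis not_le less_imp_Suc_add add_Suc_right)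
    have "j = j' * b ^ Suc d"
      using that(1) assms by (simp add: d power_add)
    moreover have "b ^ Suc d \<ge> b" using assms by simp
    ultimately have "j \<ge> b" using that(3) by (metis One_nat_def Suc_leI mult_le_mono nat_mult_1)
    with that(2) show False by simp
  qed
  have inj: "inj_on ?f ?A"
  proof (rule inj_onI, clarify)
    fix j i j' i'
    assume *: "j \<in> {1..b - 1}" "j' \<in> {1..b - 1}" "j * b ^ i = j' * b ^ i'"
    have "j < b" "j' < b" "0 < j" "0 < j'" using * assms by auto
    then have "i = i'" using le[of j i j' i'] le[of j' i' j i] *(3) by simp
    then show "j = j' \<and> i = i'" using * assms by simp
  qed
  have "link_distances b n = ?f ` ?A"
    unfolding link_distances_def by force
  then show ?thesis
    using card_image[OF inj] by (simp add: num_scales_def)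
qed

definition neighbors :: "nat \<Rightarrow> nat \<Rightarrow> int \<Rightarrow> int set" where
  "neighbors b n u = {v \<in> nodes n. nat \<bar>u - v\<bar> \<in> link_distances b n}"

text \<open>
  A node may have two neighbors closest to the target, one on each side of it, so greedy routing
  is a relation. A message rests once it is at the target; one at a node without neighbors is
  stuck there and is never delivered.
\<close>

definition greedy_step :: "nat \<Rightarrow> nat \<Rightarrow> int \<Rightarrow> int \<Rightarrow> int \<Rightarrow> bool" where
  "greedy_step b n t u v \<longleftrightarrow>
     (if u = t \<or> neighbors b n u = {} then v = u
      else is_arg_min (\<lambda>w. \<bar>w - t\<bar>) (\<lambda>w. w \<in> neighbors b n u) v)"

definition greedy_route :: "nat \<Rightarrow> nat \<Rightarrow> int \<Rightarrow> int \<Rightarrow> (nat \<Rightarrow> int) \<Rightarrow> bool" where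
  "greedy_route b n s t r \<longleftrightarrow> r 0 = s \<and> (\<forall>i. greedy_step b n t (r i) (r (Suc i)))"

text \<open>The infimum of the empty set is \<open>\<infinity>\<close>: the case of a message that never arrives.\<close>

definition hops :: "int \<Rightarrow> (nat \<Rightarrow> int) \<Rightarrow> enat" where
  "hops t r = Inf {enat k | k. r k = t}"

text \<open>The worst case over all sources, targets and ways of breaking ties.\<close>

definition delivery_time :: "nat \<Rightarrow> nat \<Rightarrow> enat" where
  "delivery_time b n =
     Sup {hops t r | s t r. s \<in> nodes n \<and> t \<in> nodes n \<and> greedy_route b n s t r}"

end

theory Submission
  imports Defs
begin

text \<open>
  Write the distance \<open>d\<close> to the target in base \<open>b\<close> and let \<open>j * b ^ i\<close> be the contribution of its
  leading digit. The node \<open>j * b ^ i\<close> closer to the target is a neighbor at distance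
  \<open>d mod b ^ i < b ^ i\<close> from it. The greedy choice does at least as well, possibly by overshooting,
  so every hop removes at least one digit, and a distance below \<open>n\<close> has at most
  \<open>\<lceil>log\<^sub>b n\<rceil>\<close> of them.
\<close>

text \<open>Starts the digit count: every distance between nodes is below \<open>n\<close>, so its
  base-\<open>b\<close> digits all sit at positions for which links exist.\<close>

lemma le_power_num_scales:
  assumes "b > 1"
  shows "n \<le> b ^ num_scales b n"
proof (cases "n = 0")
  case False
  have "log b n \<le> num_scales b n"
    unfolding num_scales_def by linarith
  then have "real n \<le> real b powr num_scales b n"
    using False assms by (simp add: log_le_iff)
  also have "\<dots> = real (b ^ num_scales b n)"
    using assms by (simp add: powr_realpow)
  finally show ?thesis
    by (simp only: of_nat_le_iff)
qed simp

lemma leading_digit_exists: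
  fixes b d k :: nat
  assumes "0 < d" "d < b ^ k"
  shows "\<exists>i<k. b ^ i \<le> d \<and> d < b ^ Suc i"
  using assms
proof (induction k)
  case (Suc k)
  then show ?case
    by (metis less_Suc_eq not_le)
qed simp

lemma exists_closer_neighbor:
  assumes b: "b > 1" and u: "u \<in> nodes n" and t: "t \<in> nodes n" and "u \<noteq> t"
    and k: "Suc k \<le> num_scales b n" and d: "\<bar>u - t\<bar> < int (b ^ Suc k)"
  shows "\<exists>v \<in> neighbors b n u. \<bar>v - t\<bar> < int (b ^ k)"
proof -
  define d where "d = nat \<bar>u - t\<bar>"
  have "0 < d" "d < b ^ Suc k"
    using \<open>u \<noteq> t\<close> d unfolding d_def by linarith+
  then obtain i where i: "i < Suc k" "b ^ i \<le> d" "d < b ^ Suc i"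
    using leading_digit_exists by blast
  define j where "j = d div b ^ i"
  define e where "e = j * b ^ i"
  have j: "1 \<le> j" "j < b"
    using i b by (auto simp: j_def div_greater_zero_iff less_mult_imp_div_less Suc_le_eq)
  have e: "0 < e" "e \<le> d"
    using j b by (simp_all add: e_def j_def)
  have "d - e = d mod b ^ i"
    by (simp add: e_def j_def minus_div_mult_eq_mod)
  also have "\<dots> < b ^ i"
    using b by simp
  \<comment> \<open>The leading digit of \<open>d\<close> may sit below position \<open>k\<close>,
    so the remainder bound is weakened from \<open>i\<close> to \<open>k\<close>.\<close>
  also have "\<dots> \<le> b ^ k"
    using b i by (intro power_increasing) auto
  \<comment> \<open>\<open>e \<le> d\<close> makes the truncated difference equal to the integer
    one.\<close>
  finally have de: "int d - int e < int (b ^ k)"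
    using e by linarith
  have "j \<le> b - 1" "i < num_scales b n"
    using i k j by simp_all
  then have link: "e \<in> link_distances b n"
    unfolding link_distances_def e_def using j by blast
  \<comment> \<open>Moving by \<open>e \<le> d\<close> towards \<open>t\<close> cannot overshoot, so
    \<open>v\<close> stays between two nodes and is itself a node.\<close>
  define v where "v = (if u < t then u + int e else u - int e)"
  have "v \<in> nodes n" "\<bar>v - t\<bar> = int d - int e" "nat \<bar>u - v\<bar> = e"
    using u t e by (auto simp: v_def nodes_def d_def)
  then show ?thesis
    using link de by (auto simp: neighbors_def)
qed

text \<open>The bound also survives early arrival: a message resting at the target has distance 0,
  below every \<open>b ^ k\<close>.\<close>

lemma greedy_step_decreases:
  assumes "b > 1" "u \<in> nodes n" "t \<in> nodes n"
    and "Suc k \<le> num_scales b n" "\<bar>u - t\<bar> < int (b ^ Suc k)"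
    and step: "greedy_step b n t u v"
  shows "v \<in> nodes n \<and> \<bar>v - t\<bar> < int (b ^ k)"
proof (cases "u = t")
  case True
  then show ?thesis
    using assms by (simp add: greedy_step_def)
next
  case False
  then obtain w where w: "w \<in> neighbors b n u" "\<bar>w - t\<bar> < int (b ^ k)"
    using exists_closer_neighbor assms by blast
  \<comment> \<open>The neighbor \<open>w\<close> rules out the stuck case of
    \<open>greedy_step\<close>.\<close>
  then have "is_arg_min (\<lambda>w. \<bar>w - t\<bar>) (\<lambda>w. w \<in> neighbors b n u) v"
    using step False by (auto simp: greedy_step_def split: if_splits)
  then have "v \<in> neighbors b n u" "\<bar>v - t\<bar> \<le> \<bar>w - t\<bar>"
    using w by (auto simp: is_arg_min_linorder)
  then show ?thesis
    using w by (simp add: neighbors_def)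
qed

lemma greedy_route_distance:
  assumes "b > 1" "s \<in> nodes n" "t \<in> nodes n" and r: "greedy_route b n s t r"
    and "k \<le> num_scales b n"
  shows "r k \<in> nodes n \<and> \<bar>r k - t\<bar> < int (b ^ (num_scales b n - k))"
  using assms(5)
proof (induction k)
  case 0
  have "\<bar>s - t\<bar> < int n"
    using assms by (auto simp: nodes_def)
  also have "\<dots> \<le> int (b ^ num_scales b n)"
    using le_power_num_scales[OF \<open>b > 1\<close>] by (simp only: of_nat_le_iff)
  finally show ?case
    using assms by (simp add: greedy_route_def)
next
  case (Suc k)
  have "num_scales b n - k = Suc (num_scales b n - Suc k)"
    using Suc.prems by simp
  moreover have "greedy_step b n t (r k) (r (Suc k))"
    using r by (simp add: greedy_route_def)
  ultimately show ?case
    using Suc assms greedy_step_decreases[of b "r k" n t "num_scales b n - Suc k" "r (Suc k)"]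
    by simp
qed

lemma delivery_time_le_num_scales:
  assumes "b > 1"
  shows "delivery_time b n \<le> enat (num_scales b n)"
  unfolding delivery_time_def
proof (rule Sup_least, clarify)
  fix s t r
  assume "s \<in> nodes n" "t \<in> nodes n" "greedy_route b n s t r"
  \<comment> \<open>After \<open>num_scales b n\<close> hops the distance is below
    \<open>b ^ 0 = 1\<close>, hence zero.\<close>
  then have "r (num_scales b n) = t"
    using greedy_route_distance[of b s n t r "num_scales b n"] assms by simp
  then show "hops t r \<le> enat (num_scales b n)"
    unfolding hops_def by (intro Inf_lower) blast
qed

text \<open>Rounding up adds less than 1, which \<open>n \<ge> b\<close> absorbs into a second
  logarithm. For \<open>1 < n < b\<close> there is one scale, while the logarithm can be arbitrarily
  close to 0.\<close>

lemma num_scales_le_log: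
  assumes "b > 1" "n \<ge> b"
  shows "real (num_scales b n) \<le> 2 * log (real b) (real n)"
proof -
  have "1 \<le> log b n"
    using assms by (simp add: le_log_iff)
  then show ?thesis
    unfolding num_scales_def by linarith
qed

text \<open>Finiteness is stated separately so that \<open>the_enat\<close> yields the true delivery
  time. The last conjunct excludes a constant that depends on \<open>b\<close>; the proof takes
  \<open>C = 2\<close>.\<close>

theorem theorem6:
  "(\<forall>b>1. (\<forall>n. delivery_time b n < \<infinity>) \<and>
      (\<lambda>n. real (the_enat (delivery_time b n))) \<in> O(\<lambda>n. log (real b) (real n))) \<and>
   (\<exists>C. \<forall>b>1. \<forall>n\<ge>b. ereal_of_enat (delivery_time b n) \<le> ereal (C * log (real b) (real n)))"
proof -
  have fin: "\<exists>T. delivery_time b n = enat T \<and> T \<le> num_scales b n" if "b > 1" for b n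
    using delivery_time_le_num_scales[OF that, of n] by (cases "delivery_time b n") auto
  have bound: "\<exists>T. delivery_time b n = enat T \<and> real T \<le> 2 * log b n" if "b > 1" "n \<ge> b" for b n
    using fin[OF that(1), of n] num_scales_le_log[OF that] by fastforce
  have "(\<lambda>n. real (the_enat (delivery_time b n))) \<in> O(\<lambda>n. log (real b) (real n))"
    if "b > 1" for b
  proof (rule bigoI)
    show "\<forall>\<^sub>F n in sequentially.
      norm (real (the_enat (delivery_time b n))) \<le> 2 * norm (log (real b) (real n))"
      using eventually_ge_at_top[of b]
    proof eventually_elim
      case (elim n)
      then show ?case
        using bound[OF that elim] by auto
    qed
  qed
  moreover have "delivery_time b n < \<infinity>" if "b > 1" for b n
    using fin[OF that, of n] by auto
  moreover have "ereal_of_enat (delivery_time b n) \<le> ereal (2 * log (real b) (real n))"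
    if "b > 1" "n \<ge> b" for b n
    using bound[OF that] by auto
  ultimately show ?thesis
    by blast
qed

end
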